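(* Let $G_1,G_2$ be finite groups. For $K_i\leq G_i$, $i=1,2$, denote by $\mathbf{A}_{K_1,K_2}$ the class incidence matrix of $N_{G_1}(K_1)\times N_{G_2}(K_2)$ acting (by conjugation) on the subposet of $(\mathcal{S}_{G_1\times G_2},\leq)$ consisting of those subgroups $L$ with bottom groups $k_i(L)=K_i$, $i=1,2$. Then $$\mathbf{A}(\leq_K)=\bigoplus_{\substack{[K_i]\in\mathcal{S}_{G_i}/G_i\\ i=1,2}}\mathbf{A}_{K_1,K_2},$$ where $\mathbf{A}(\leq_K)$ is the class incidence matrix of the $(G_1\times G_2)$-poset $(\mathcal{S}_{G_1\times G_2},\leq_K)$.
   Context: For a finite group $G$, $\mathcal{S}_G$ is the set of subgroups of $G$, ordered by inclusion $\leq$, and $\mathcal{S}_G/G$ is the set of conjugacy classes $[H]$ of subgroups. For $L\leq G_1\times G_2$ let $p_i(L)\leq G_i$ be the projection of $L$ to $G_i$, and $k_1(L)=\{a_1\in G_1:(a_1,1)\in L\}$, $k_2(L)=\{a_2\in G_2:(1,a_2)\in L\}$ (the bottom groups of $L$; $k_i(L)\trianglelefteq p_i(L)$). For $L',L\leq G_1\times G_2$ write $L'\leq_K L$ if $L'\leq L$ and $k_i(L')=k_i(L)$ for $i=1,2$ (the subscript $K$ is just the name of the relation). $G_1\times G_2$ acts on $\mathcal{S}_{G_1\times G_2}$ by conjugation. Class incidence matrix: if a finite group $G$ acts on a finite poset $(X,\preceq)$ preserving the order, and $T\subseteq X$ is a transversal of the $G$-orbits, then the class incidence matrix is $(\mathbf{a}_{xy})_{x,y\in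 T}$ with $\mathbf{a}_{xy}=\#\{x'\in X : x'\text{ in the }G\text{-orbit of }x,\ y\preceq x'\}$. The direct sum denotes the block diagonal matrix, one block for each pair of conjugacy classes $([K_1],[K_2])$ with chosen representatives $K_1,K_2$; the union of the transversals used for the blocks serves as transversal of the conjugacy classes of subgroups of $G_1\times G_2$. *)

theory Defs
  imports "HOL-Algebra.Group_Action" "HOL-Library.FuncSet" "HOL-Library.Disjoint_Sets"
begin

locale finite_poset_action = group_action G X \<phi>
  for G (structure) and X and \<phi> +
  fixes preceq :: "'x \<Rightarrow> 'x \<Rightarrow> bool"
  assumes finite_group: "finite (carrier G)"
    and finite_poset: "finite X"
    and partial_order: "partial_order_on X (relation_of preceq X)"
    and mono: "\<lbrakk>g \<in> carrier G; x \<in> X; y \<in> X; preceq x y\<rbrakk> \<Longrightarrow> preceq (\<phi> g x) (\<phi> g y)"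

definition orbit_transversal ::
  "('g, 'm) monoid_scheme \<Rightarrow> 'x set \<Rightarrow> ('g \<Rightarrow> 'x \<Rightarrow> 'x) \<Rightarrow> 'x set \<Rightarrow> bool" where
  "orbit_transversal G X \<phi> T \<longleftrightarrow> T \<subseteq> X \<and> (\<forall>B \<in> orbits G X \<phi>. \<exists>!t. t \<in> T \<inter> B)"

text \<open>A matrix with rows and columns indexed by a set \<open>T\<close> is an extensional function on
  \<open>T \<times> T\<close>, so that equality of matrices includes equality of the index sets.\<close>

definition class_incidence_matrix ::
  "('g, 'm) monoid_scheme \<Rightarrow> 'x set \<Rightarrow> ('g \<Rightarrow> 'x \<Rightarrow> 'x) \<Rightarrow> ('x \<Rightarrow> 'x \<Rightarrow> bool) \<Rightarrow> 'x set
    \<Rightarrow> 'x \<times> 'x \<Rightarrow> nat" where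
  "class_incidence_matrix G X \<phi> preceq T =
     (\<lambda>(x, y) \<in> T \<times> T. card {x' \<in> X. x' \<in> orbit G \<phi> x \<and> preceq y x'})"

text \<open>The block diagonal matrix with blocks \<open>A i\<close>, where \<open>A i\<close> is indexed by \<open>T i\<close>.
  It is only meaningful if the index sets \<open>T i\<close> are pairwise disjoint.\<close>

definition matrix_direct_sum ::
  "'i set \<Rightarrow> ('i \<Rightarrow> 'x set) \<Rightarrow> ('i \<Rightarrow> 'x \<times> 'x \<Rightarrow> 'a::zero) \<Rightarrow> 'x \<times> 'x \<Rightarrow> 'a" where
  "matrix_direct_sum I T A =
     (\<lambda>(x, y) \<in> (\<Union>i\<in>I. T i) \<times> (\<Union>i\<in>I. T i).
        if \<exists>i\<in>I. x \<in> T i \<and> y \<in> T i then A (THE i. i \<in> I \<and> x \<in> T i \<and> y \<in> T i) (x, y) else 0)"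

definition subgroups_of :: "('g, 'm) monoid_scheme \<Rightarrow> 'g set set" where
  "subgroups_of G = {H. subgroup H G}"

definition conj_action :: "('g, 'm) monoid_scheme \<Rightarrow> 'g set set \<Rightarrow> 'g \<Rightarrow> 'g set \<Rightarrow> 'g set" where
  "conj_action G X = (\<lambda>g. \<lambda>H \<in> X. g <#\<^bsub>G\<^esub> H #>\<^bsub>G\<^esub> (inv\<^bsub>G\<^esub> g))"

definition bottom1 ::
  "('a, 'm) monoid_scheme \<Rightarrow> ('b, 'n) monoid_scheme \<Rightarrow> ('a \<times> 'b) set \<Rightarrow> 'a set" where
  "bottom1 G1 G2 L = {a \<in> carrier G1. (a, \<one>\<^bsub>G2\<^esub>) \<in> L}"

definition bottom2 ::
  "('a, 'm) monoid_scheme \<Rightarrow> ('b, 'n) monoid_scheme \<Rightarrow> ('a \<times> 'b) set \<Rightarrow> 'b set" where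
  "bottom2 G1 G2 L = {b \<in> carrier G2. (\<one>\<^bsub>G1\<^esub>, b) \<in> L}"

definition le_K ::
  "('a, 'm) monoid_scheme \<Rightarrow> ('b, 'n) monoid_scheme \<Rightarrow> ('a \<times> 'b) set \<Rightarrow> ('a \<times> 'b) set \<Rightarrow> bool" where
  "le_K G1 G2 L' L \<longleftrightarrow>
     L' \<subseteq> L \<and> bottom1 G1 G2 L' = bottom1 G1 G2 L \<and> bottom2 G1 G2 L' = bottom2 G1 G2 L"

definition subgroups_with_bottoms ::
  "('a, 'm) monoid_scheme \<Rightarrow> ('b, 'n) monoid_scheme \<Rightarrow> 'a set \<Rightarrow> 'b set \<Rightarrow> ('a \<times> 'b) set set" where
  "subgroups_with_bottoms G1 G2 K1 K2 =
     {L \<in> subgroups_of (G1 \<times>\<times> G2). bottom1 G1 G2 L = K1 \<and> bottom2 G1 G2 L = K2}"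

definition normalizer_prod ::
  "('a, 'm) monoid_scheme \<Rightarrow> ('b, 'n) monoid_scheme \<Rightarrow> 'a set \<Rightarrow> 'b set \<Rightarrow> ('a \<times> 'b) monoid" where
  "normalizer_prod G1 G2 K1 K2 =
     G1\<lparr>carrier := normalizer G1 K1\<rparr> \<times>\<times> G2\<lparr>carrier := normalizer G2 K2\<rparr>"

definition block_matrix ::
  "('a, 'm) monoid_scheme \<Rightarrow> ('b, 'n) monoid_scheme \<Rightarrow> 'a set \<Rightarrow> 'b set \<Rightarrow> ('a \<times> 'b) set set
    \<Rightarrow> ('a \<times> 'b) set \<times> ('a \<times> 'b) set \<Rightarrow> nat" where
  "block_matrix G1 G2 K1 K2 T =
     class_incidence_matrix (normalizer_prod G1 G2 K1 K2) (subgroups_with_bottoms G1 G2 K1 K2)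
       (conj_action (G1 \<times>\<times> G2) (subgroups_with_bottoms G1 G2 K1 K2)) (\<subseteq>) T"

definition le_K_matrix ::
  "('a, 'm) monoid_scheme \<Rightarrow> ('b, 'n) monoid_scheme \<Rightarrow> ('a \<times> 'b) set set
    \<Rightarrow> ('a \<times> 'b) set \<times> ('a \<times> 'b) set \<Rightarrow> nat" where
  "le_K_matrix G1 G2 T =
     class_incidence_matrix (G1 \<times>\<times> G2) (subgroups_of (G1 \<times>\<times> G2))
       (conj_action (G1 \<times>\<times> G2) (subgroups_of (G1 \<times>\<times> G2))) (le_K G1 G2) T"

lemma group_action_restrict:
  assumes "group_action G E \<phi>" "subgroup H G" "F \<subseteq> E"
    and inv: "\<And>g x. g \<in> H \<Longrightarrow> x \<in> F \<Longrightarrow> \<phi> g x \<in> F"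
  shows "group_action (G\<lparr>carrier := H\<rparr>) F (\<lambda>g. restrict (\<phi> g) F)"
proof -
  interpret group_action G E \<phi> by fact
  interpret G: group G using group_hom by (rule group_hom.axioms(1))
  have HG: "H \<subseteq> carrier G" using assms(2) by (rule subgroup.subset)
  have bij: "restrict (\<phi> g) F \<in> Bij F" if g: "g \<in> H" for g
  proof -
    have gi: "inv\<^bsub>G\<^esub> g \<in> H" using assms(2) g by (rule subgroup.m_inv_closed)
    have "\<phi> g ` F = F"
    proof
      show "\<phi> g ` F \<subseteq> F" using inv[OF g] by auto
      show "F \<subseteq> \<phi> g ` F"
      proof
        fix x assume x: "x \<in> F"
        have "\<phi> g (\<phi> (inv\<^bsub>G\<^esub> g) x) = x"
          using orbit_sym_aux[of "inv\<^bsub>G\<^esub> g" x, OF _ _ refl] gi g HG x assms(3)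
          by (auto simp: subset_iff)
        then show "x \<in> \<phi> g ` F" using inv[OF gi x] by force
      qed
    qed
    moreover have "inj_on (\<phi> g) F"
      using inj_prop[of g] g HG assms(3) by (meson inj_on_subset subsetD)
    ultimately show ?thesis by (simp add: Bij_def bij_betw_def)
  qed
  have "restrict (\<phi> (g \<otimes>\<^bsub>G\<^esub> h)) F = restrict (\<phi> g) F \<otimes>\<^bsub>BijGroup F\<^esub> restrict (\<phi> h) F"
    if "g \<in> H" "h \<in> H" for g h
    using that bij inv HG assms(3)
    by (auto simp: BijGroup_def compose_def fun_eq_iff restrict_def composition_rule subset_iff)
  then have "(\<lambda>g. restrict (\<phi> g) F) \<in> hom (G\<lparr>carrier := H\<rparr>) (BijGroup F)"
    using bij by (auto simp: hom_def BijGroup_def)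
  then show ?thesis
    using G.subgroup_imp_group[OF assms(2)] group_BijGroup
    by (simp add: group_action_def group_hom_def group_hom_axioms_def)
qed

lemma conj_mono:
  "H \<subseteq> H' \<Longrightarrow> g <#\<^bsub>G\<^esub> H #>\<^bsub>G\<^esub> g' \<subseteq> g <#\<^bsub>G\<^esub> H' #>\<^bsub>G\<^esub> g'"
  by (auto simp: l_coset_def r_coset_def)

lemma
  assumes "group G1" "group G2" "g1 \<in> carrier G1" "g2 \<in> carrier G2" "subgroup L (G1 \<times>\<times> G2)"
  shows bottom1_conj: "bottom1 G1 G2 ((g1, g2) <#\<^bsub>G1 \<times>\<times> G2\<^esub> L #>\<^bsub>G1 \<times>\<times> G2\<^esub> inv\<^bsub>G1 \<times>\<times> G2\<^esub> (g1, g2))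
          = g1 <#\<^bsub>G1\<^esub> bottom1 G1 G2 L #>\<^bsub>G1\<^esub> inv\<^bsub>G1\<^esub> g1" (is ?A)
    and bottom2_conj: "bottom2 G1 G2 ((g1, g2) <#\<^bsub>G1 \<times>\<times> G2\<^esub> L #>\<^bsub>G1 \<times>\<times> G2\<^esub> inv\<^bsub>G1 \<times>\<times> G2\<^esub> (g1, g2))
          = g2 <#\<^bsub>G2\<^esub> bottom2 G1 G2 L #>\<^bsub>G2\<^esub> inv\<^bsub>G2\<^esub> g2" (is ?B)
proof -
  interpret G1: group G1 by fact
  interpret G2: group G2 by fact
  have LG: "L \<subseteq> carrier G1 \<times> carrier G2"
    using subgroup.subset[OF assms(5)] by simp
  have conj: "(g1, g2) <#\<^bsub>G1 \<times>\<times> G2\<^esub> L #>\<^bsub>G1 \<times>\<times> G2\<^esub> inv\<^bsub>G1 \<times>\<times> G2\<^esub> (g1, g2) =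
      {(g1 \<otimes>\<^bsub>G1\<^esub> a \<otimes>\<^bsub>G1\<^esub> inv\<^bsub>G1\<^esub> g1, g2 \<otimes>\<^bsub>G2\<^esub> b \<otimes>\<^bsub>G2\<^esub> inv\<^bsub>G2\<^esub> g2) | a b. (a, b) \<in> L}"
    using assms(1-4)
    by (simp add: l_coset_def r_coset_def set_eq_iff split_beta) (metis fst_conv mult_DirProd prod.collapse snd_conv)
  have one1: "a = \<one>\<^bsub>G1\<^esub>" if "a \<in> carrier G1" "\<one>\<^bsub>G1\<^esub> = g1 \<otimes>\<^bsub>G1\<^esub> a \<otimes>\<^bsub>G1\<^esub> inv\<^bsub>G1\<^esub> g1" for a
    using that assms(3) by (metis G1.conjugation_is_inj G1.one_closed G1.r_inv G1.r_one)
  have one2: "b = \<one>\<^bsub>G2\<^esub>" if "b \<in> carrier G2" "\<one>\<^bsub>G2\<^esub> = g2 \<otimes>\<^bsub>G2\<^esub> b \<otimes>\<^bsub>G2\<^esub> inv\<^bsub>G2\<^esub> g2" for b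
    using that assms(4) by (metis G2.conjugation_is_inj G2.one_closed G2.r_inv G2.r_one)
  have c1: "\<one>\<^bsub>G1\<^esub> = g1 \<otimes>\<^bsub>G1\<^esub> \<one>\<^bsub>G1\<^esub> \<otimes>\<^bsub>G1\<^esub> inv\<^bsub>G1\<^esub> g1" using assms(3) by simp
  have c2: "\<one>\<^bsub>G2\<^esub> = g2 \<otimes>\<^bsub>G2\<^esub> \<one>\<^bsub>G2\<^esub> \<otimes>\<^bsub>G2\<^esub> inv\<^bsub>G2\<^esub> g2" using assms(4) by simp
  show ?A
  proof (rule Set.set_eqI)
    fix x
    have "x \<in> bottom1 G1 G2 ((g1, g2) <#\<^bsub>G1 \<times>\<times> G2\<^esub> L #>\<^bsub>G1 \<times>\<times> G2\<^esub> inv\<^bsub>G1 \<times>\<times> G2\<^esub> (g1, g2)) \<longleftrightarrow>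
        (\<exists>a. (a, \<one>\<^bsub>G2\<^esub>) \<in> L \<and> x = g1 \<otimes>\<^bsub>G1\<^esub> a \<otimes>\<^bsub>G1\<^esub> inv\<^bsub>G1\<^esub> g1)"
      unfolding bottom1_def conj using LG one2 c2 assms(3) by blast
    also have "\<dots> \<longleftrightarrow> x \<in> g1 <#\<^bsub>G1\<^esub> bottom1 G1 G2 L #>\<^bsub>G1\<^esub> inv\<^bsub>G1\<^esub> g1"
      using LG by (auto simp: bottom1_def l_coset_def r_coset_def)
    finally show "x \<in> bottom1 G1 G2 ((g1, g2) <#\<^bsub>G1 \<times>\<times> G2\<^esub> L #>\<^bsub>G1 \<times>\<times> G2\<^esub> inv\<^bsub>G1 \<times>\<times> G2\<^esub> (g1, g2)) \<longleftrightarrow>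
        x \<in> g1 <#\<^bsub>G1\<^esub> bottom1 G1 G2 L #>\<^bsub>G1\<^esub> inv\<^bsub>G1\<^esub> g1" .
  qed
  show ?B
  proof (rule Set.set_eqI)
    fix x
    have "x \<in> bottom2 G1 G2 ((g1, g2) <#\<^bsub>G1 \<times>\<times> G2\<^esub> L #>\<^bsub>G1 \<times>\<times> G2\<^esub> inv\<^bsub>G1 \<times>\<times> G2\<^esub> (g1, g2)) \<longleftrightarrow>
        (\<exists>b. (\<one>\<^bsub>G1\<^esub>, b) \<in> L \<and> x = g2 \<otimes>\<^bsub>G2\<^esub> b \<otimes>\<^bsub>G2\<^esub> inv\<^bsub>G2\<^esub> g2)"
      unfolding bottom2_def conj using LG one1 c1 assms(4) by blast
    also have "\<dots> \<longleftrightarrow> x \<in> g2 <#\<^bsub>G2\<^esub> bottom2 G1 G2 L #>\<^bsub>G2\<^esub> inv\<^bsub>G2\<^esub> g2"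
      using LG by (auto simp: bottom2_def l_coset_def r_coset_def)
    finally show "x \<in> bottom2 G1 G2 ((g1, g2) <#\<^bsub>G1 \<times>\<times> G2\<^esub> L #>\<^bsub>G1 \<times>\<times> G2\<^esub> inv\<^bsub>G1 \<times>\<times> G2\<^esub> (g1, g2)) \<longleftrightarrow>
        x \<in> g2 <#\<^bsub>G2\<^esub> bottom2 G1 G2 L #>\<^bsub>G2\<^esub> inv\<^bsub>G2\<^esub> g2" .
  qed
qed

lemma finite_subgroups_of: "finite (carrier G) \<Longrightarrow> finite (subgroups_of G)"
  by (rule finite_subset[of _ "Pow (carrier G)"]) (auto simp: subgroups_of_def dest: subgroup.subset)

lemma normalizer_conj:
  assumes "g \<in> normalizer G H" "H \<subseteq> carrier G"
  shows "g \<in> carrier G" "g <#\<^bsub>G\<^esub> H #>\<^bsub>G\<^esub> inv\<^bsub>G\<^esub> g = H"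
  using assms by (auto simp: normalizer_def stabilizer_def)

lemma le_K_poset_action:
  assumes "group G1" "group G2" "finite (carrier G1)" "finite (carrier G2)"
  shows "finite_poset_action (G1 \<times>\<times> G2) (subgroups_of (G1 \<times>\<times> G2))
           (conj_action (G1 \<times>\<times> G2) (subgroups_of (G1 \<times>\<times> G2))) (le_K G1 G2)"
proof -
  interpret P: group "G1 \<times>\<times> G2" using assms by (simp add: DirProd_group)
  show ?thesis
    unfolding finite_poset_action_def finite_poset_action_axioms_def
  proof (intro conjI allI impI)
    show "group_action (G1 \<times>\<times> G2) (subgroups_of (G1 \<times>\<times> G2))
           (conj_action (G1 \<times>\<times> G2) (subgroups_of (G1 \<times>\<times> G2)))"
      using P.action_by_conjugation_on_subgroups_set by (simp add: conj_action_def subgroups_of_def)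
    show "partial_order_on (subgroups_of (G1 \<times>\<times> G2))
           (relation_of (le_K G1 G2) (subgroups_of (G1 \<times>\<times> G2)))"
      by (rule partial_order_on_relation_ofI) (auto simp: le_K_def)
  next
    fix g L L'
    assume "g \<in> carrier (G1 \<times>\<times> G2)" "L \<in> subgroups_of (G1 \<times>\<times> G2)"
      "L' \<in> subgroups_of (G1 \<times>\<times> G2)" "le_K G1 G2 L L'"
    then show "le_K G1 G2 (conj_action (G1 \<times>\<times> G2) (subgroups_of (G1 \<times>\<times> G2)) g L)
        (conj_action (G1 \<times>\<times> G2) (subgroups_of (G1 \<times>\<times> G2)) g L')"
      using assms(1,2)
      by (cases g) (simp add: le_K_def conj_action_def subgroups_of_def conj_mono
          bottom1_conj bottom2_conj del: inv_DirProd)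
  qed (use assms in \<open>simp_all add: finite_subgroups_of\<close>)
qed

lemma block_poset_action:
  assumes "group G1" "group G2" "finite (carrier G1)" "finite (carrier G2)"
    and "subgroup K1 G1" "subgroup K2 G2"
  shows "finite_poset_action (normalizer_prod G1 G2 K1 K2) (subgroups_with_bottoms G1 G2 K1 K2)
           (conj_action (G1 \<times>\<times> G2) (subgroups_with_bottoms G1 G2 K1 K2)) (\<subseteq>)"
proof -
  interpret P: group "G1 \<times>\<times> G2" using assms by (simp add: DirProd_group)
  let ?P = "G1 \<times>\<times> G2" and ?X = "subgroups_with_bottoms G1 G2 K1 K2"
  let ?N1 = "normalizer G1 K1" and ?N2 = "normalizer G2 K2"
  have sub: "K1 \<subseteq> carrier G1" "K2 \<subseteq> carrier G2"
    using assms(5,6) by (auto dest: subgroup.subset)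
  have N: "subgroup ?N1 G1" "subgroup ?N2 G2"
    using assms(1,2) sub by (auto intro: group.normalizer_imp_subgroup)
  have NP: "subgroup (?N1 \<times> ?N2) ?P"
    using assms(1,2) N by (simp add: DirProd_subgroups)
  have eq: "normalizer_prod G1 G2 K1 K2 = ?P\<lparr>carrier := ?N1 \<times> ?N2\<rparr>"
    by (simp add: normalizer_prod_def DirProd_def)
  have XS: "?X \<subseteq> {H. subgroup H ?P}"
    by (auto simp: subgroups_with_bottoms_def subgroups_of_def)
  have act: "group_action (?P\<lparr>carrier := ?N1 \<times> ?N2\<rparr>) ?X
      (\<lambda>g. restrict ((\<lambda>g. \<lambda>H \<in> {H. subgroup H ?P}. g <#\<^bsub>?P\<^esub> H #>\<^bsub>?P\<^esub> (inv\<^bsub>?P\<^esub> g)) g) ?X)"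
  proof (rule group_action_restrict[OF P.action_by_conjugation_on_subgroups_set NP XS])
    fix g L assume g: "g \<in> ?N1 \<times> ?N2" and L: "L \<in> ?X"
    obtain g1 g2 where g12: "g = (g1, g2)" "g1 \<in> ?N1" "g2 \<in> ?N2" using g by auto
    have "g1 \<in> carrier G1" "g2 \<in> carrier G2"
      using g12 sub normalizer_conj(1) by fastforce+
    then show "(\<lambda>H \<in> {H. subgroup H ?P}. g <#\<^bsub>?P\<^esub> H #>\<^bsub>?P\<^esub> (inv\<^bsub>?P\<^esub> g)) L \<in> ?X"
      using L assms(1,2) g12 sub P.subgroup_conjugation_is_surj2[of g L]
      by (simp add: subgroups_with_bottoms_def subgroups_of_def bottom1_conj bottom2_conj
          normalizer_conj(2) del: inv_DirProd)
  qed
  have "(\<lambda>g. restrict ((\<lambda>g. \<lambda>H \<in> {H. subgroup H ?P}. g <#\<^bsub>?P\<^esub> H #>\<^bsub>?P\<^esub> (inv\<^bsub>?P\<^esub> g)) g) ?X)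
      = conj_action ?P ?X"
    using XS by (auto simp: conj_action_def fun_eq_iff restrict_def)
  with act have act': "group_action (normalizer_prod G1 G2 K1 K2) ?X (conj_action ?P ?X)"
    by (simp add: eq)
  show ?thesis
    unfolding finite_poset_action_def finite_poset_action_axioms_def
  proof (intro conjI allI impI act')
    show "finite (carrier (normalizer_prod G1 G2 K1 K2))"
      using N assms(3,4) by (auto simp: eq intro: finite_subset dest: subgroup.subset)
    show "finite ?X"
      using finite_subgroups_of[of ?P] assms(3,4) by (simp add: subgroups_with_bottoms_def)
    show "partial_order_on ?X (relation_of (\<subseteq>) ?X)"
      by (rule partial_order_on_relation_ofI) auto
  qed (simp add: conj_action_def conj_mono)
qed

end

(* The two bottom groups form a conjugation-equivariant map on the subgroups of the product, so
   each orbit meets the fibre over (K1, K2) in at most one orbit of the stabilizer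
   N(K1) x N(K2), and in exactly one if (K1, K2) represents the image orbit. Since subgroups
   related by the order have the same image, only pairs in a common fibre contribute to the
   incidence matrix. *)

theory Submission
  imports Defs
begin

section \<open>Transversals and block diagonal matrices\<close>

lemma orbit_transversal_iff:
  "orbit_transversal G X \<phi> T \<longleftrightarrow> T \<subseteq> X \<and> (\<forall>x\<in>X. \<exists>!t. t \<in> T \<and> t \<in> orbit G \<phi> x)"
  by (auto simp: orbit_transversal_def orbits_def)

text \<open>Disjointness of the index sets attaches each row and each column to a single block, so
  the definite description in \<open>matrix_direct_sum\<close> has exactly one candidate on the
  diagonal and none off it.\<close>

lemma matrix_direct_sum_apply:
  assumes "disjoint_family_on T I" "i \<in> I" "j \<in> I" "x \<in> T i" "y \<in> T j"
  shows "matrix_direct_sum I T A (x, y) = (if i = j then A i (x, y) else 0)"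
proof -
  have uniq: "k = l" if "k \<in> I" "l \<in> I" "z \<in> T k" "z \<in> T l" for k l z
    using assms(1) that by (auto simp: disjoint_family_on_def)
  have mem: "(x, y) \<in> (\<Union>i\<in>I. T i) \<times> (\<Union>i\<in>I. T i)"
    using assms by auto
  show ?thesis
  proof (cases "i = j")
    case True
    then have "(THE k. k \<in> I \<and> x \<in> T k \<and> y \<in> T k) = i"
      using assms uniq by (intro the_equality) auto
    moreover have "\<exists>k\<in>I. x \<in> T k \<and> y \<in> T k"
      using assms True by auto
    ultimately show ?thesis
      using mem True by (simp add: matrix_direct_sum_def)
  next
    case False
    then have "\<not> (\<exists>k\<in>I. x \<in> T k \<and> y \<in> T k)"
      using assms uniq by metis
    then show ?thesis
      using mem False by (auto simp: matrix_direct_sum_def)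
  qed
qed

text \<open>Matrices are functions on a whole type: extensionality settles the values outside the
  index set, so only genuine entries remain to be compared.\<close>

lemma matrix_direct_sum_eqI:
  assumes "disjoint_family_on T I" "M \<in> extensional ((\<Union>i\<in>I. T i) \<times> (\<Union>i\<in>I. T i))"
    and "\<And>i j x y. \<lbrakk>i \<in> I; j \<in> I; x \<in> T i; y \<in> T j\<rbrakk>
           \<Longrightarrow> M (x, y) = (if i = j then A i (x, y) else 0)"
  shows "M = matrix_direct_sum I T A"
proof (rule extensionalityI[OF assms(2)])
  show "matrix_direct_sum I T A \<in> extensional ((\<Union>i\<in>I. T i) \<times> (\<Union>i\<in>I. T i))"
    by (simp add: matrix_direct_sum_def)
  fix p assume "p \<in> (\<Union>i\<in>I. T i) \<times> (\<Union>i\<in>I. T i)"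
  then obtain x y i j where p: "p = (x, y)" "i \<in> I" "j \<in> I" "x \<in> T i" "y \<in> T j" by blast
  show "M p = matrix_direct_sum I T A p"
    unfolding p(1) assms(3)[OF p(2-5)] matrix_direct_sum_apply[OF assms(1) p(2-5)] ..
qed

text \<open>Disjointness guarantees that the index selected by \<open>THE\<close> lies in
  \<open>I\<close>, where \<open>A\<close> and \<open>B\<close> agree.\<close>

lemma matrix_direct_sum_cong:
  assumes "disjoint_family_on T I" "\<And>i. i \<in> I \<Longrightarrow> A i = B i"
  shows "matrix_direct_sum I T A = matrix_direct_sum I T B"
proof (rule matrix_direct_sum_eqI[OF assms(1)])
  show "matrix_direct_sum I T A \<in> extensional ((\<Union>i\<in>I. T i) \<times> (\<Union>i\<in>I. T i))"
    by (simp add: matrix_direct_sum_def)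
qed (simp add: matrix_direct_sum_apply[OF assms(1)] assms(2))

section \<open>Class incidence matrices along an equivariant map\<close>

locale equivariant_map = group_action G X \<phi>
  for G :: "('g, 'm) monoid_scheme" (structure) and X :: "'x set" and \<phi> +
  fixes \<psi> :: "'g \<Rightarrow> 'y \<Rightarrow> 'y" and k :: "'x \<Rightarrow> 'y"
  assumes equivariant: "\<lbrakk>g \<in> carrier G; x \<in> X\<rbrakk> \<Longrightarrow> k (\<phi> g x) = \<psi> g (k x)"
begin

definition fibre :: "'y \<Rightarrow> 'x set" where
  "fibre y = {x \<in> X. k x = y}"

abbreviation stabilizer_group :: "'y \<Rightarrow> _" where
  "stabilizer_group y \<equiv> G\<lparr>carrier := stabilizer G \<psi> y\<rparr>"

abbreviation fibre_action :: "'y \<Rightarrow> 'g \<Rightarrow> 'x \<Rightarrow> 'x" where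
  "fibre_action y \<equiv> \<lambda>g. restrict (\<phi> g) (fibre y)"

text \<open>If \<open>g\<close> moves \<open>x\<close> to another point of the fibre over
  \<open>y\<close>, then equivariance gives \<open>y = \<psi> g y\<close>, so \<open>g\<close>
  already lies in the stabilizer of \<open>y\<close>.\<close>

lemma fibre_orbit:
  assumes "x \<in> fibre y"
  shows "orbit (stabilizer_group y) (fibre_action y) x = orbit G \<phi> x \<inter> fibre y"
  using assms element_image equivariant
  by (auto simp: orbit_def stabilizer_def fibre_def)

lemma k_orbit: "\<lbrakk>x \<in> X; x' \<in> orbit G \<phi> x\<rbrakk> \<Longrightarrow> k x' \<in> orbit G \<psi> (k x)"
  using equivariant by (auto simp: orbit_def)

text \<open>\<open>R\<close> represents the orbits met by the image of \<open>k\<close>. This is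
  phrased through the values \<open>k x\<close>, since \<open>\<psi>\<close> comes without a set on
  which it acts.\<close>

context
  fixes R :: "'y set" and T :: "'y \<Rightarrow> 'x set"
  assumes base: "\<And>x. x \<in> X \<Longrightarrow> \<exists>!r. r \<in> R \<and> r \<in> orbit G \<psi> (k x)"
    and blocks: "\<And>r. r \<in> R \<Longrightarrow>
      orbit_transversal (stabilizer_group r) (fibre r) (fibre_action r) (T r)"
begin

lemma block_subset: "r \<in> R \<Longrightarrow> T r \<subseteq> fibre r"
  using blocks by (simp add: orbit_transversal_def)

text \<open>Since \<open>T r\<close> lies in the fibre, \<open>fibre_orbit\<close> lets the full
  orbit replace the orbit of the stabilizer.\<close>

lemma block_ex1: "\<lbrakk>r \<in> R; x \<in> fibre r\<rbrakk> \<Longrightarrow> \<exists>!t. t \<in> T r \<and> t \<in> orbit G \<phi> x"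
  using blocks[of r] block_subset[of r]
  by (auto simp: orbit_transversal_iff fibre_orbit subset_iff)

lemma blocks_disjoint: "disjoint_family_on T R"
  using block_subset unfolding disjoint_family_on_def fibre_def by blast

text \<open>Both values lie in the \<open>\<psi>\<close>-orbit of \<open>k x\<close>, which contains
  only one element of \<open>R\<close>.\<close>

lemma k_orbit_unique:
  assumes "x \<in> X" "x1 \<in> orbit G \<phi> x" "x2 \<in> orbit G \<phi> x" "k x1 \<in> R" "k x2 \<in> R"
  shows "k x1 = k x2"
  using base[OF assms(1)] k_orbit[OF assms(1)] assms by blast

lemma union_transversal: "orbit_transversal G X \<phi> (\<Union>r\<in>R. T r)"
  unfolding orbit_transversal_iff
proof (intro conjI ballI)
  show "(\<Union>r\<in>R. T r) \<subseteq> X"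
    using block_subset by (auto simp: fibre_def)
  fix x assume x: "x \<in> X"
  \<comment> \<open>The element \<open>g\<close> that takes \<open>k x\<close> to its representative
    \<open>r\<close> also moves \<open>x\<close> into the fibre over \<open>r\<close>, where the
    block \<open>T r\<close> is available.\<close>
  obtain r g where r: "r \<in> R" "g \<in> carrier G" "r = \<psi> g (k x)"
    using base[OF x] by (auto simp: orbit_def)
  have gx: "\<phi> g x \<in> X" "\<phi> g x \<in> orbit G \<phi> x"
    using element_image[OF r(2) x refl] r(2) by (auto simp: orbit_def)
  then have "\<phi> g x \<in> fibre r"
    using r x equivariant by (simp add: fibre_def)
  then obtain t where t: "t \<in> T r" "t \<in> orbit G \<phi> (\<phi> g x)"
    using block_ex1[OF r(1)] by blast
  have tr: "t \<in> fibre r" using block_subset[OF r(1)] t by blast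
  then have tX: "t \<in> X" "k t = r" by (auto simp: fibre_def)
  have tx: "t \<in> orbit G \<phi> x"
    by (rule orbit_trans[OF x gx(1) tX(1) gx(2) t(2)])
  show "\<exists>!t. t \<in> (\<Union>r\<in>R. T r) \<and> t \<in> orbit G \<phi> x"
  proof (rule ex1I[of _ t])
    show "t \<in> (\<Union>r\<in>R. T r) \<and> t \<in> orbit G \<phi> x" using r t tx by blast
    \<comment> \<open>A competitor \<open>u\<close> must come from the same block. Uniqueness is
      then applied to the orbit of \<open>t\<close> instead of \<open>x\<close>, because
      \<open>x\<close> itself need not lie in the fibre over \<open>r\<close>.\<close>
    fix u assume "u \<in> (\<Union>r\<in>R. T r) \<and> u \<in> orbit G \<phi> x"
    then obtain s where u: "s \<in> R" "u \<in> T s" "u \<in> orbit G \<phi> x" by blast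
    have us: "u \<in> X" "k u = s" using block_subset u by (auto simp: fibre_def)
    have "s = r"
      using k_orbit_unique[OF x u(3) tx] us tX u(1) r(1) by simp
    moreover have "u \<in> orbit G \<phi> t"
      using orbit_trans[OF tX(1) x us(1) orbit_sym[OF x tX(1) tx] u(3)] .
    moreover have "t \<in> orbit G \<phi> t" by (rule orbit_refl[OF tX(1)])
    ultimately show "u = t" using block_ex1[OF r(1) tr] t(1) u(2) by blast
  qed
qed

text \<open>The entry at \<open>(x, y)\<close> counts only those points of the orbit of
  \<open>x\<close> that lie in the fibre of \<open>y\<close>. Within one block these form the
  stabilizer orbit by \<open>fibre_orbit\<close>; across two blocks there are none by
  \<open>k_orbit_unique\<close>.\<close>

theorem class_incidence_matrix_fibrewise:
  "class_incidence_matrix G X \<phi> (\<lambda>x x'. preceq x x' \<and> k x = k x') (\<Union>r\<in>R. T r) =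
     matrix_direct_sum R T
       (\<lambda>r. class_incidence_matrix (stabilizer_group r) (fibre r) (fibre_action r) preceq (T r))"
proof (rule matrix_direct_sum_eqI[OF blocks_disjoint])
  show "class_incidence_matrix G X \<phi> (\<lambda>x x'. preceq x x' \<and> k x = k x') (\<Union>r\<in>R. T r)
      \<in> extensional ((\<Union>r\<in>R. T r) \<times> (\<Union>r\<in>R. T r))"
    by (simp add: class_incidence_matrix_def)
  fix r s x y assume rs: "r \<in> R" "s \<in> R" and xy: "x \<in> T r" "y \<in> T s"
  have x: "x \<in> X" "k x = r" "x \<in> fibre r" and y: "k y = s"
    using block_subset rs xy by (auto simp: fibre_def)
  let ?A = "{x' \<in> X. x' \<in> orbit G \<phi> x \<and> preceq y x' \<and> k y = k x'}"
  have "class_incidence_matrix G X \<phi> (\<lambda>x x'. preceq x x' \<and> k x = k x') (\<Union>r\<in>R. T r) (x, y)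
      = card ?A"
    using rs xy by (auto simp: class_incidence_matrix_def)
  also have "\<dots> = (if r = s then class_incidence_matrix (stabilizer_group r) (fibre r)
      (fibre_action r) preceq (T r) (x, y) else 0)"
  proof (cases "r = s")
    case True
    then have "?A = {x' \<in> fibre r. x' \<in> orbit G \<phi> x \<and> preceq y x'}"
      using y by (auto simp: fibre_def)
    also have "\<dots> = {x' \<in> fibre r.
        x' \<in> orbit (stabilizer_group r) (fibre_action r) x \<and> preceq y x'}"
      using x by (auto simp: fibre_orbit)
    finally show ?thesis
      using True xy by (simp add: class_incidence_matrix_def)
  next
    case False
    \<comment> \<open>A point of \<open>?A\<close> would be in the orbit of \<open>x\<close> and
      have value \<open>s\<close>, while \<open>x\<close> has value \<open>r\<close>; both values
      are in \<open>R\<close>.\<close>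
    have "?A = {}"
      using k_orbit_unique[OF x(1) orbit_refl[OF x(1)]] x(2) y rs False by auto
    show ?thesis unfolding \<open>?A = {}\<close> using False by simp
  qed
  finally show "class_incidence_matrix G X \<phi> (\<lambda>x x'. preceq x x' \<and> k x = k x') (\<Union>r\<in>R. T r) (x, y)
      = (if r = s then class_incidence_matrix (stabilizer_group r) (fibre r)
      (fibre_action r) preceq (T r) (x, y) else 0)" .
qed

end

end

section \<open>Bottom groups, normalizers and conjugation on pairs\<close>

lemma subgroup_bottom1:
  assumes "group G1" "group G2" "subgroup L (G1 \<times>\<times> G2)"
  shows "subgroup (bottom1 G1 G2 L) G1"
proof -
  interpret G1: group G1 by fact
  interpret G2: group G2 by fact
  interpret L: subgroup L "G1 \<times>\<times> G2" by fact
  show ?thesis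
  proof
    fix a b assume "a \<in> bottom1 G1 G2 L" "b \<in> bottom1 G1 G2 L"
    then show "a \<otimes>\<^bsub>G1\<^esub> b \<in> bottom1 G1 G2 L"
      using L.m_closed[of "(a, \<one>\<^bsub>G2\<^esub>)" "(b, \<one>\<^bsub>G2\<^esub>)"] by (simp add: bottom1_def)
  next
    fix a assume "a \<in> bottom1 G1 G2 L"
    then show "inv\<^bsub>G1\<^esub> a \<in> bottom1 G1 G2 L"
      using L.m_inv_closed[of "(a, \<one>\<^bsub>G2\<^esub>)"] assms(1,2) by (simp add: bottom1_def)
  qed (use L.one_closed in \<open>auto simp: bottom1_def\<close>)
qed

lemma subgroup_bottom2:
  assumes "group G1" "group G2" "subgroup L (G1 \<times>\<times> G2)"
  shows "subgroup (bottom2 G1 G2 L) G2"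
proof -
  interpret G1: group G1 by fact
  interpret G2: group G2 by fact
  interpret L: subgroup L "G1 \<times>\<times> G2" by fact
  show ?thesis
  proof
    fix a b assume "a \<in> bottom2 G1 G2 L" "b \<in> bottom2 G1 G2 L"
    then show "a \<otimes>\<^bsub>G2\<^esub> b \<in> bottom2 G1 G2 L"
      using L.m_closed[of "(\<one>\<^bsub>G1\<^esub>, a)" "(\<one>\<^bsub>G1\<^esub>, b)"] by (simp add: bottom2_def)
  next
    fix a assume "a \<in> bottom2 G1 G2 L"
    then show "inv\<^bsub>G2\<^esub> a \<in> bottom2 G1 G2 L"
      using L.m_inv_closed[of "(\<one>\<^bsub>G1\<^esub>, a)"] assms(1,2) by (simp add: bottom2_def)
  qed (use L.one_closed in \<open>auto simp: bottom2_def\<close>)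
qed

text \<open>The normalizer is the stabilizer for conjugation on all subsets of the carrier; at a
  subgroup, restricting the action to subgroups changes nothing.\<close>

lemma stabilizer_conj_action:
  assumes "subgroup H G"
  shows "stabilizer G (conj_action G (subgroups_of G)) H = normalizer G H"
  using assms subgroup.subset[OF assms]
  by (simp add: stabilizer_def normalizer_def conj_action_def subgroups_of_def)

text \<open>The two components of a group element vary independently.\<close>

lemma orbit_DirProd:
  "orbit (G \<times>\<times> H) (\<lambda>g. map_prod (\<phi> (fst g)) (\<psi> (snd g))) (x, y) = orbit G \<phi> x \<times> orbit H \<psi> y"
  by (force simp: orbit_def)

lemma stabilizer_DirProd:
  "stabilizer (G \<times>\<times> H) (\<lambda>g. map_prod (\<phi> (fst g)) (\<psi> (snd g))) (x, y)
     = stabilizer G \<phi> x \<times> stabilizer H \<psi> y"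
  by (auto simp: stabilizer_def)

text \<open>\<open>conj_action\<close> is \<open>undefined\<close> outside its set, so the equation
  needs the bottom groups to be subgroups as well as the conjugation formulas for them.\<close>

lemma bottoms_equivariant:
  assumes "group G1" "group G2"
  shows "equivariant_map (G1 \<times>\<times> G2) (subgroups_of (G1 \<times>\<times> G2))
    (conj_action (G1 \<times>\<times> G2) (subgroups_of (G1 \<times>\<times> G2)))
    (\<lambda>g. map_prod (conj_action G1 (subgroups_of G1) (fst g)) (conj_action G2 (subgroups_of G2) (snd g)))
    (\<lambda>L. (bottom1 G1 G2 L, bottom2 G1 G2 L))"
proof -
  interpret P: group "G1 \<times>\<times> G2" using assms by (simp add: DirProd_group)
  show ?thesis
    unfolding equivariant_map_def equivariant_map_axioms_def
  proof (intro conjI allI impI)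
    show "group_action (G1 \<times>\<times> G2) (subgroups_of (G1 \<times>\<times> G2))
        (conj_action (G1 \<times>\<times> G2) (subgroups_of (G1 \<times>\<times> G2)))"
      using P.action_by_conjugation_on_subgroups_set by (simp add: conj_action_def subgroups_of_def)
  qed (use assms in \<open>auto simp: conj_action_def subgroups_of_def bottom1_conj bottom2_conj
      subgroup_bottom1 subgroup_bottom2 simp del: inv_DirProd\<close>)
qed

section \<open>Block decomposition for \<open>le_K\<close>\<close>

theorem theorem6p2:
  fixes G1 :: "('a, 'm) monoid_scheme" and G2 :: "('b, 'n) monoid_scheme"
    and R1 :: "'a set set" and R2 :: "'b set set"
    and T :: "'a set \<times> 'b set \<Rightarrow> ('a \<times> 'b) set set"
  assumes "group G1" and "finite (carrier G1)"
    and "group G2" and "finite (carrier G2)"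
    and "orbit_transversal G1 (subgroups_of G1) (conj_action G1 (subgroups_of G1)) R1"
    and "orbit_transversal G2 (subgroups_of G2) (conj_action G2 (subgroups_of G2)) R2"
    and "\<And>K1 K2. K1 \<in> R1 \<Longrightarrow> K2 \<in> R2 \<Longrightarrow>
           orbit_transversal (normalizer_prod G1 G2 K1 K2) (subgroups_with_bottoms G1 G2 K1 K2)
             (conj_action (G1 \<times>\<times> G2) (subgroups_with_bottoms G1 G2 K1 K2)) (T (K1, K2))"
  shows "disjoint_family_on T (R1 \<times> R2)
    \<and> orbit_transversal (G1 \<times>\<times> G2) (subgroups_of (G1 \<times>\<times> G2))
           (conj_action (G1 \<times>\<times> G2) (subgroups_of (G1 \<times>\<times> G2))) (\<Union>K \<in> R1 \<times> R2. T K)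
    \<and> le_K_matrix G1 G2 (\<Union>K \<in> R1 \<times> R2. T K) =
           matrix_direct_sum (R1 \<times> R2) T (\<lambda>(K1, K2). block_matrix G1 G2 K1 K2 (T (K1, K2)))"
proof -
  interpret equivariant_map "G1 \<times>\<times> G2" "subgroups_of (G1 \<times>\<times> G2)"
    "conj_action (G1 \<times>\<times> G2) (subgroups_of (G1 \<times>\<times> G2))"
    "\<lambda>g. map_prod (conj_action G1 (subgroups_of G1) (fst g)) (conj_action G2 (subgroups_of G2) (snd g))"
    "\<lambda>L. (bottom1 G1 G2 L, bottom2 G1 G2 L)"
    using assms(1,3) by (rule bottoms_equivariant)
  have fibre: "fibre (K1, K2) = subgroups_with_bottoms G1 G2 K1 K2" for K1 K2
    by (auto simp: fibre_def subgroups_with_bottoms_def)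
  have action: "fibre_action (K1, K2) = conj_action (G1 \<times>\<times> G2) (subgroups_with_bottoms G1 G2 K1 K2)"
    for K1 K2
    unfolding fibre by (auto simp: conj_action_def subgroups_with_bottoms_def fun_eq_iff restrict_def)
  have group: "stabilizer_group (K1, K2) = normalizer_prod G1 G2 K1 K2"
    if "(K1, K2) \<in> R1 \<times> R2" for K1 K2
  proof -
    have "subgroup K1 G1" "subgroup K2 G2"
      using that assms(5,6) by (auto simp: orbit_transversal_def subgroups_of_def)
    then show ?thesis
      \<comment> \<open>The product stays folded while \<open>stabilizer_DirProd\<close> is matched;
        unfolding it afterwards identifies the restricted product with the product of the restricted
        groups.\<close>
      by (simp add: stabilizer_DirProd stabilizer_conj_action normalizer_prod_def)
        (simp add: DirProd_def)
  qed
  have base: "\<exists>!r. r \<in> R1 \<times> R2 \<and> r \<in> orbit (G1 \<times>\<times> G2)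
      (\<lambda>g. map_prod (conj_action G1 (subgroups_of G1) (fst g)) (conj_action G2 (subgroups_of G2) (snd g)))
      (bottom1 G1 G2 L, bottom2 G1 G2 L)" if "L \<in> subgroups_of (G1 \<times>\<times> G2)" for L
  proof -
    have "bottom1 G1 G2 L \<in> subgroups_of G1" "bottom2 G1 G2 L \<in> subgroups_of G2"
      using that assms(1,3) by (simp_all add: subgroups_of_def subgroup_bottom1 subgroup_bottom2)
    then have "\<exists>!r. r \<in> R1 \<and> r \<in> orbit G1 (conj_action G1 (subgroups_of G1)) (bottom1 G1 G2 L)"
      "\<exists>!r. r \<in> R2 \<and> r \<in> orbit G2 (conj_action G2 (subgroups_of G2)) (bottom2 G1 G2 L)"
      using assms(5,6) by (simp_all add: orbit_transversal_iff)
    then show ?thesis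
      \<comment> \<open>The orbit of the pair is a product of orbits, so a unique representative in
        each factor gives a unique pair.\<close>
      unfolding orbit_DirProd by auto
  qed
  have blocks: "orbit_transversal (stabilizer_group r) (fibre r) (fibre_action r) (T r)"
    if "r \<in> R1 \<times> R2" for r
    \<comment> \<open>\<open>action\<close> is applied before \<open>fibre\<close>, which would
      rewrite the term \<open>fibre (K1, K2)\<close> hidden in \<open>fibre_action\<close>.\<close>
    using that assms(7) group by (cases r) (simp add: action, simp add: fibre)
  \<comment> \<open>This is the shape required by \<open>class_incidence_matrix_fibrewise\<close>,
    with plain inclusion as the order left inside each block.\<close>
  have le: "le_K G1 G2 = (\<lambda>L L'. L \<subseteq> L' \<and>
      (bottom1 G1 G2 L, bottom2 G1 G2 L) = (bottom1 G1 G2 L', bottom2 G1 G2 L'))"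
    by (simp add: le_K_def fun_eq_iff)
  have block: "class_incidence_matrix (stabilizer_group r) (fibre r) (fibre_action r) (\<subseteq>) (T r)
      = (\<lambda>(K1, K2). block_matrix G1 G2 K1 K2 (T (K1, K2))) r" if "r \<in> R1 \<times> R2" for r
    using that group by (cases r) (simp add: action block_matrix_def, simp add: fibre)
  have "le_K_matrix G1 G2 (\<Union>K \<in> R1 \<times> R2. T K) = matrix_direct_sum (R1 \<times> R2) T
      (\<lambda>r. class_incidence_matrix (stabilizer_group r) (fibre r) (fibre_action r) (\<subseteq>) (T r))"
    unfolding le_K_matrix_def le by (rule class_incidence_matrix_fibrewise[OF base blocks])
  also have "\<dots> = matrix_direct_sum (R1 \<times> R2) T
      (\<lambda>(K1, K2). block_matrix G1 G2 K1 K2 (T (K1, K2)))"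
    by (rule matrix_direct_sum_cong[OF blocks_disjoint[OF base blocks] block])
  finally show ?thesis
    using blocks_disjoint[OF base blocks] union_transversal[OF base blocks] by blast
qed

end
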